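(* Let $f$ be a non-negative real-valued function defined on some interval of $\mathbb{R}$ which contains $0$ as an interior point. Let $X$ be a non-degenerate (real-valued) random variable on a sublinear expectation space $(\Omega,\mathcal{H},\hat{\mathbb{E}})$, and let $Y$ be an independent copy of $X$. Suppose that for all $\lambda$ (in the domain of $f$) such that $f(\lambda)$ is non-negative, $$\lambda X+f(\lambda)Y\overset{d}{=}X .$$ Then: (i) $X$ is $G$-normally distributed; (ii) $f(\lambda)=\sqrt{1-\lambda^2}$ (for all $\lambda$ in the domain of $f$).
   Context: Sublinear expectation space: $\Omega$ is a set and $\mathcal{H}$ is a vector lattice of real-valued functions on $\Omega$ containing all constants, with $|X|\in\mathcal{H}$ whenever $X\in\mathcal{H}$; elements of $\mathcal{H}$ are called random variables. A sublinear expectation is a functional $\hat{\mathbb{E}}:\mathcal{H}\to\mathbb{R}$ such that for all $X,Y\in\mathcal{H}$: (a) $X\ge Y$ implies $\hat{\mathbb{E}}[X]\ge\hat{\mathbb{E}}[Y]$; (b) $\hat{\mathbb{E}}[c]=c$ for constants $c$; (c) $\hat{\mathbb{E}}[X+Y]\le\hat{\mathbb{E}}[X]+\hat{\mathbb{E}}[Y]$; (d) $\hat{\mathbb{E}}[\lambda X]=\lambda\hat{\mathbb{E}}[X]$ for $\lambda\ge 0$. The triple $(\Omega,\mathcal{H},\hat{\mathbb{E}})$ is called a sublinear expectation space. It is understood that functions of random variables appearing inside $\hat{\mathbb{E}}$ below (such as $X^2$, or $\varphi(X)$ and $\varphi(X,Y)$ for test functions $\varphi$) belong to $\mathcal{H}$.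 $C_{b.Lip}(\mathbb{R}^n)$ denotes the space of bounded Lipschitz functions on $\mathbb{R}^n$. Identically distributed: for $n$-dimensional random vectors $X_1,X_2$ on sublinear expectation spaces $(\Omega_1,\mathcal{H}_1,\hat{\mathbb{E}}_1)$, $(\Omega_2,\mathcal{H}_2,\hat{\mathbb{E}}_2)$, $X_1\overset{d}{=}X_2$ means $\hat{\mathbb{E}}_1[\varphi(X_1)]=\hat{\mathbb{E}}_2[\varphi(X_2)]$ for all $\varphi\in C_{b.Lip}(\mathbb{R}^n)$. Independence: an $n$-dimensional random vector $Y$ is independent of an $m$-dimensional random vector $X$ (written $Y\bot X$; this relation is not symmetric in general) if for every $\varphi\in C_{b.Lip}(\mathbb{R}^m\times\mathbb{R}^n)$, $\hat{\mathbb{E}}[\varphi(X,Y)]=\hat{\mathbb{E}}\big[\hat{\mathbb{E}}[\varphi(x,Y)]_{x=X}\big]$. An independent copy of $X$ is a random variable $\bar X$ with $\bar X\overset{d}{=}X$ and $\bar X\bot X$. $G$-normal distribution: $X$ is called $G$-normally distributed if for each $a,b\ge 0$, $aX+b\bar X\overset{d}{=}\sqrt{a^2+b^2}\,X$, where $\bar X$ is an independent copy of $X$. (Here $G$ denotes the function $G(A)=\tfrac12\hat{\mathbb{E}}[AX^2]$, $A\in\mathbb{R}$.) Non-degenerate: a random variable $X$ is non-degenerate if $\hat{\mathbb{E}}[X^2]>\big(\hat{\mathbb{E}}[|X|]\big)^2$. *)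

theory Defs
  imports "HOL-Analysis.Analysis"
begin

text \<open>
  The sample space is the type \<open>'w\<close>; it is nonempty, which \<open>E_const\<close> would force anyway.
  A sublinear expectation is a total function on \<open>'w \<Rightarrow> real\<close> of which only the values
  on \<open>H\<close> are constrained.
\<close>

locale sublinear_expectation_space =
  fixes H :: "('w \<Rightarrow> real) set"
    and E :: "('w \<Rightarrow> real) \<Rightarrow> real"
  assumes const_in_H: "(\<lambda>_. c) \<in> H"
    and add_in_H: "X \<in> H \<Longrightarrow> Y \<in> H \<Longrightarrow> (\<lambda>\<omega>. X \<omega> + Y \<omega>) \<in> H"
    and scale_in_H: "X \<in> H \<Longrightarrow> (\<lambda>\<omega>. c * X \<omega>) \<in> H"
    and max_in_H: "X \<in> H \<Longrightarrow> Y \<in> H \<Longrightarrow> (\<lambda>\<omega>. max (X \<omega>) (Y \<omega>)) \<in> H"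
    and min_in_H: "X \<in> H \<Longrightarrow> Y \<in> H \<Longrightarrow> (\<lambda>\<omega>. min (X \<omega>) (Y \<omega>)) \<in> H"
    and abs_in_H: "X \<in> H \<Longrightarrow> (\<lambda>\<omega>. \<bar>X \<omega>\<bar>) \<in> H"
    and E_mono: "X \<in> H \<Longrightarrow> Y \<in> H \<Longrightarrow> (\<And>\<omega>. X \<omega> \<ge> Y \<omega>) \<Longrightarrow> E X \<ge> E Y"
    and E_const: "E (\<lambda>_. c) = c"
    and E_subadd: "X \<in> H \<Longrightarrow> Y \<in> H \<Longrightarrow> E (\<lambda>\<omega>. X \<omega> + Y \<omega>) \<le> E X + E Y"
    and E_pos_homogeneous: "X \<in> H \<Longrightarrow> l \<ge> 0 \<Longrightarrow> E (\<lambda>\<omega>. l * X \<omega>) = l * E X"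

definition C_bLip :: "('a::euclidean_space \<Rightarrow> real) set" where
  "C_bLip = {\<phi>. bounded (range \<phi>) \<and> (\<exists>L. L-lipschitz_on UNIV \<phi>)}"

text \<open>
  The convention that the functions of random variables to which the expectation is applied
  are again random variables, as a closure property of \<open>H\<close>.  It is not cosmetic: closure under
  squares makes all moments finite, so that the second moment of a random variable is determined
  by its bounded Lipschitz test functions.
\<close>

locale sublinear_expectation_space_with_test_functions = sublinear_expectation_space +
  assumes square_in_H: "X \<in> H \<Longrightarrow> (\<lambda>\<omega>. (X \<omega>)\<^sup>2) \<in> H"
    and test_in_H: "X \<in> H \<Longrightarrow> (\<phi> :: real \<Rightarrow> real) \<in> C_bLip \<Longrightarrow> (\<lambda>\<omega>. \<phi> (X \<omega>)) \<in> H"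
    and test2_in_H: "X \<in> H \<Longrightarrow> Y \<in> H \<Longrightarrow> (\<psi> :: real \<times> real \<Rightarrow> real) \<in> C_bLip
      \<Longrightarrow> (\<lambda>\<omega>. \<psi> (X \<omega>, Y \<omega>)) \<in> H"

definition identically_distributed ::
  "(('w1 \<Rightarrow> real) \<Rightarrow> real) \<Rightarrow> ('w1 \<Rightarrow> 'a::euclidean_space)
    \<Rightarrow> (('w2 \<Rightarrow> real) \<Rightarrow> real) \<Rightarrow> ('w2 \<Rightarrow> 'a) \<Rightarrow> bool" where
  "identically_distributed E\<^sub>1 X\<^sub>1 E\<^sub>2 X\<^sub>2 \<longleftrightarrow>
    (\<forall>\<phi>\<in>C_bLip. E\<^sub>1 (\<lambda>\<omega>. \<phi> (X\<^sub>1 \<omega>)) = E\<^sub>2 (\<lambda>\<omega>. \<phi> (X\<^sub>2 \<omega>)))"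

text \<open>\<open>independent_of E Y X\<close> reads ``\<open>Y\<close> is independent of \<open>X\<close>''; the order matters.\<close>

definition independent_of ::
  "(('w \<Rightarrow> real) \<Rightarrow> real) \<Rightarrow> ('w \<Rightarrow> 'b::euclidean_space)
    \<Rightarrow> ('w \<Rightarrow> 'a::euclidean_space) \<Rightarrow> bool" where
  "independent_of E Y X \<longleftrightarrow>
    (\<forall>\<phi>\<in>C_bLip. E (\<lambda>\<omega>. \<phi> (X \<omega>, Y \<omega>)) = E (\<lambda>\<omega>. (\<lambda>x. E (\<lambda>\<omega>'. \<phi> (x, Y \<omega>'))) (X \<omega>)))"

definition independent_copy ::
  "('w \<Rightarrow> real) set \<Rightarrow> (('w \<Rightarrow> real) \<Rightarrow> real) \<Rightarrow> ('w \<Rightarrow> real) \<Rightarrow> ('w \<Rightarrow> real) \<Rightarrow> bool" where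
  "independent_copy H E X' X \<longleftrightarrow>
    X' \<in> H \<and> identically_distributed E X' E X \<and> independent_of E X' X"

text \<open>
  The distribution of \<open>a X + b X'\<close> does not depend on the choice of the independent copy \<open>X'\<close>,
  so all of them are required to satisfy the identity; existence of one is required so that the
  condition is never vacuous.
\<close>

definition G_normal ::
  "('w \<Rightarrow> real) set \<Rightarrow> (('w \<Rightarrow> real) \<Rightarrow> real) \<Rightarrow> ('w \<Rightarrow> real) \<Rightarrow> bool" where
  "G_normal H E X \<longleftrightarrow>
    X \<in> H \<and> (\<exists>X'. independent_copy H E X' X) \<and>
    (\<forall>X'. independent_copy H E X' X \<longrightarrow>
      (\<forall>a\<ge>0. \<forall>b\<ge>0. identically_distributed
        E (\<lambda>\<omega>. a * X \<omega> + b * X' \<omega>) E (\<lambda>\<omega>. sqrt (a\<^sup>2 + b\<^sup>2) * X \<omega>)))"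

definition non_degenerate :: "(('w \<Rightarrow> real) \<Rightarrow> real) \<Rightarrow> ('w \<Rightarrow> real) \<Rightarrow> bool" where
  "non_degenerate E X \<longleftrightarrow> E (\<lambda>\<omega>. (X \<omega>)\<^sup>2) > (E (\<lambda>\<omega>. \<bar>X \<omega>\<bar>))\<^sup>2"

end

theory Submission
  imports Defs
begin

text \<open>
  Testing the stability identity against \<open>x\<close>, \<open>-x\<close> and \<open>x\<^sup>2\<close> determines \<open>f\<close>: non-degeneracy forces
  the upper and lower means of \<open>X\<close> to vanish, and then the cross term drops out of the second
  moment, leaving \<open>l\<^sup>2 + (f l)\<^sup>2 = 1\<close>.  These test functions are unbounded; a truncation controlled by
  fourth moments legitimates them.  For normality, the operators \<open>Q s \<phi> x = E \<phi>(x + sqrt s X)\<close> on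
  bounded Lipschitz functions satisfy \<open>Q s (Q t \<phi>) = Q (s + t) \<phi>\<close> by the identity just obtained,
  as long as \<open>s / t\<close> is small; associativity of composition removes this restriction, and at the
  point \<open>0\<close> the law is the defining property of the G-normal distribution.
\<close>

section \<open>Bounded Lipschitz test functions and truncation\<close>

lemma C_bLipI:
  assumes "L-lipschitz_on UNIV \<phi>" "\<And>z. \<bar>\<phi> z\<bar> \<le> B"
  shows "\<phi> \<in> C_bLip"
  using assms unfolding C_bLip_def bounded_iff by auto

lemma C_bLipE:
  assumes "\<phi> \<in> C_bLip"
  obtains L B where "L-lipschitz_on UNIV \<phi>" "\<And>z. \<bar>\<phi> z\<bar> \<le> B"
  using assms unfolding C_bLip_def bounded_iff by auto

lemma C_bLip_compose:
  assumes "\<phi> \<in> C_bLip" "L-lipschitz_on UNIV g"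
  shows "(\<lambda>z. \<phi> (g z)) \<in> C_bLip"
proof -
  obtain M B where M: "M-lipschitz_on UNIV \<phi>" and B: "\<And>z. \<bar>\<phi> z\<bar> \<le> B"
    using assms(1) by (rule C_bLipE) blast
  show ?thesis
  proof (rule C_bLipI)
    show "(M * L)-lipschitz_on UNIV (\<lambda>z. \<phi> (g z))"
      using assms(2) M by (intro lipschitz_on_compose2) (auto intro: lipschitz_on_subset)
  qed (rule B)
qed

text \<open>Boundedness of each factor keeps the product Lipschitz. This lets a product of unbounded
  functions be truncated factor by factor.\<close>

lemma C_bLip_mult:
  assumes "\<phi> \<in> C_bLip" "\<psi> \<in> C_bLip"
  shows "(\<lambda>z. \<phi> z * \<psi> z) \<in> C_bLip"
proof -
  obtain L B where L: "L-lipschitz_on UNIV \<phi>" and B: "\<And>z. \<bar>\<phi> z\<bar> \<le> B"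
    using assms(1) by (rule C_bLipE) blast
  obtain M C where M: "M-lipschitz_on UNIV \<psi>" and C: "\<And>z. \<bar>\<psi> z\<bar> \<le> C"
    using assms(2) by (rule C_bLipE) blast
  have B0: "B \<ge> 0" and C0: "C \<ge> 0"
    using B C abs_ge_zero order_trans by blast+
  have L0: "L \<ge> 0" and M0: "M \<ge> 0"
    using L M lipschitz_on_nonneg by blast+
  show ?thesis
  proof (rule C_bLipI)
    show "(B * M + L * C)-lipschitz_on UNIV (\<lambda>z. \<phi> z * \<psi> z)"
    proof (rule lipschitz_onI)
      fix x y
      have "\<phi> x * \<psi> x - \<phi> y * \<psi> y = \<phi> x * (\<psi> x - \<psi> y) + (\<phi> x - \<phi> y) * \<psi> y"
        by (simp add: algebra_simps)
      then have "\<bar>\<phi> x * \<psi> x - \<phi> y * \<psi> y\<bar> \<le> \<bar>\<phi> x\<bar> * \<bar>\<psi> x - \<psi> y\<bar> + \<bar>\<phi> x - \<phi> y\<bar> * \<bar>\<psi> y\<bar>"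
        by (metis abs_mult abs_triangle_ineq)
      also have "\<dots> \<le> B * (M * dist x y) + (L * dist x y) * C"
        using B C B0 C0 L0 M0 lipschitz_onD[OF L, of x y] lipschitz_onD[OF M, of x y]
        by (intro add_mono mult_mono) (auto simp: dist_real_def)
      finally show "dist (\<phi> x * \<psi> x) (\<phi> y * \<psi> y) \<le> (B * M + L * C) * dist x y"
        by (simp add: dist_real_def algebra_simps)
    qed (use B0 C0 L0 M0 in simp)
    show "\<bar>\<phi> z * \<psi> z\<bar> \<le> B * C" for z
      unfolding abs_mult using B C B0 by (intro mult_mono) auto
  qed
qed

lemma lipschitz_on_real_linear_growth:
  fixes u :: "'a::real_normed_vector \<Rightarrow> real"
  assumes "L-lipschitz_on UNIV u"
  shows "\<bar>u z\<bar> \<le> (L + \<bar>u 0\<bar>) * (1 + norm z)"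
proof -
  have "\<bar>u z\<bar> \<le> \<bar>u 0\<bar> + L * norm z"
    using lipschitz_onD[OF assms, of z 0] by (simp add: dist_real_def)
  also have "\<dots> \<le> (L + \<bar>u 0\<bar>) * (1 + norm z)"
    using lipschitz_on_nonneg[OF assms] by (simp add: algebra_simps)
  finally show ?thesis .
qed

text \<open>Composing with the projection onto a large ball makes the function bounded and Lipschitz;
  the error lives outside the ball, where it is absorbed by two extra powers of the norm.\<close>

lemma lipschitz_product_truncation:
  fixes u v :: "'a::euclidean_space \<Rightarrow> real"
  assumes u: "L-lipschitz_on UNIV u" and v: "M-lipschitz_on UNIV v" and e: "e > 0"
  shows "\<exists>\<phi>\<in>C_bLip. \<forall>z. \<bar>u z * v z - \<phi> z\<bar> \<le> e * ((norm z)\<^sup>2 + (norm z)^4)"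
proof -
  \<comment> \<open>One constant dominating both Lipschitz constants and both linear growth bounds,
    so that \<open>u\<close> and \<open>v\<close> can be treated alike.\<close>
  define K where "K = 1 + L + M + \<bar>u 0\<bar> + \<bar>v 0\<bar>"
  have L0: "L \<ge> 0" and M0: "M \<ge> 0"
    using u v lipschitz_on_nonneg by blast+
  have K1: "K \<ge> 1" using L0 M0 by (simp add: K_def)
  have gu: "\<bar>u z\<bar> \<le> K * (1 + norm z)" for z
    using L0 M0 by (intro order_trans[OF lipschitz_on_real_linear_growth[OF u]] mult_right_mono)
      (simp_all add: K_def)
  have gv: "\<bar>v z\<bar> \<le> K * (1 + norm z)" for z
    using L0 M0 by (intro order_trans[OF lipschitz_on_real_linear_growth[OF v]] mult_right_mono)
      (simp_all add: K_def)
  have "K-lipschitz_on UNIV u" "K-lipschitz_on UNIV v"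
    using L0 M0 by (auto simp: K_def intro: lipschitz_on_mono[OF u] lipschitz_on_mono[OF v])
  then have lu: "\<bar>u z - u w\<bar> \<le> K * norm (z - w)" and lv: "\<bar>v z - v w\<bar> \<le> K * norm (z - w)" for z w
    by (auto dest: lipschitz_on_normD)
  \<comment> \<open>The radius for which \<open>2 * K\<^sup>2 / N = e / 2\<close>; the factor one
    half is spent below when \<open>1 + ?n\<close> is replaced by
    \<open>2 + 2 * ?n\<^sup>2\<close>.\<close>
  define N where "N = 4 * K\<^sup>2 / e"
  have N: "N > 0" using K1 e by (simp add: N_def)
  define c where "c = closest_point (cball (0::'a) N)"
  have cN: "norm (c z) \<le> N" for z
    using closest_point_in_set[of "cball (0::'a) N" z] N by (simp add: c_def)
  have c_id: "c z = z" if "norm z \<le> N" for z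
    using that by (simp add: c_def closest_point_self)
  have c_le: "norm (c z) \<le> norm z" for z
    using cN[of z] c_id[of z] by (cases "norm z \<le> N") auto
  \<comment> \<open>Inside the ball the error is zero; outside, \<open>N\<close> is below
    \<open>norm z\<close>, and the projection moves \<open>z\<close> no farther than the centre
    would.\<close>
  have c_err: "norm (z - c z) * N \<le> (norm z)\<^sup>2" for z
  proof (cases "norm z \<le> N")
    case False
    have "norm (z - c z) \<le> norm z"
      using closest_point_le[of "cball (0::'a) N" 0 z] N by (simp add: c_def dist_norm)
    then show ?thesis
      using False N unfolding power2_eq_square by (intro mult_mono) auto
  qed (simp add: c_id)
  have c_lip: "1-lipschitz_on UNIV c"
    unfolding c_def
    by (rule lipschitz_onI) (use N in \<open>simp_all add: closest_point_lipschitz\<close>)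
  have "(\<lambda>z. u (c z)) \<in> C_bLip"
  proof (rule C_bLipI)
    show "(L * 1)-lipschitz_on UNIV (\<lambda>z. u (c z))"
      using c_lip u by (intro lipschitz_on_compose2) (auto intro: lipschitz_on_subset)
    show "\<bar>u (c z)\<bar> \<le> K * (1 + N)" for z
      using cN[of z] K1 by (intro order_trans[OF gu] mult_left_mono) auto
  qed
  moreover have "(\<lambda>z. v (c z)) \<in> C_bLip"
  proof (rule C_bLipI)
    show "(M * 1)-lipschitz_on UNIV (\<lambda>z. v (c z))"
      using c_lip v by (intro lipschitz_on_compose2) (auto intro: lipschitz_on_subset)
    show "\<bar>v (c z)\<bar> \<le> K * (1 + N)" for z
      using cN[of z] K1 by (intro order_trans[OF gv] mult_left_mono) auto
  qed
  ultimately have "(\<lambda>z. u (c z) * v (c z)) \<in> C_bLip"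
    by (rule C_bLip_mult)
  moreover have "\<bar>u z * v z - u (c z) * v (c z)\<bar> \<le> e * ((norm z)\<^sup>2 + (norm z)^4)" for z
  proof -
    let ?n = "norm z" and ?d = "norm (z - c z)"
    have "u z * v z - u (c z) * v (c z) = (u z - u (c z)) * v z + u (c z) * (v z - v (c z))"
      by (simp add: algebra_simps)
    moreover have gu_c: "\<bar>u (c z)\<bar> \<le> K * (1 + ?n)"
      using K1 c_le[of z] by (intro order_trans[OF gu] mult_left_mono) simp_all
    ultimately have "\<bar>u z * v z - u (c z) * v (c z)\<bar>
        \<le> \<bar>u z - u (c z)\<bar> * \<bar>v z\<bar> + \<bar>u (c z)\<bar> * \<bar>v z - v (c z)\<bar>"
      by (metis abs_mult abs_triangle_ineq)
    also have "\<dots> \<le> (K * ?d) * (K * (1 + ?n)) + (K * (1 + ?n)) * (K * ?d)"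
      using K1 gu_c lu[of z "c z"] lv[of z "c z"] gv[of z]
      by (intro add_mono mult_mono) simp_all
    also have "\<dots> = 2 * K\<^sup>2 * (1 + ?n) * ?d"
      by (simp add: power2_eq_square algebra_simps)
    also have "\<dots> \<le> 2 * K\<^sup>2 * (1 + ?n) * (?n\<^sup>2 / N)"
      using c_err[of z] N by (intro mult_left_mono) (simp_all add: pos_le_divide_eq)
    also have "\<dots> = (e / 2) * ((1 + ?n) * ?n\<^sup>2)"
      using K1 e by (simp add: N_def power2_eq_square)
    \<comment> \<open>The cubic term is traded for even powers of the norm, which for a pair are
      polynomials in the coordinates.\<close>
    also have "\<dots> \<le> (e / 2) * ((2 + 2 * ?n\<^sup>2) * ?n\<^sup>2)"
    proof (intro mult_left_mono mult_right_mono)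
      have "0 \<le> (?n - 1)\<^sup>2" by simp
      then have "2 * ?n \<le> ?n\<^sup>2 + 1" by (simp add: power2_diff)
      moreover have "0 \<le> ?n\<^sup>2" by simp
      ultimately show "1 + ?n \<le> 2 + 2 * ?n\<^sup>2" by linarith
    qed (use e in auto)
    also have "\<dots> = e * (?n\<^sup>2 + ?n^4)"
      by (simp add: power2_eq_square power4_eq_xxxx algebra_simps)
    finally show ?thesis .
  qed
  ultimately show ?thesis
    by (intro bexI[where x = "\<lambda>z. u (c z) * v (c z)"] allI)
qed

lemma lipschitz_on_fst:
  "1-lipschitz_on A (fst :: 'a::real_normed_vector \<times> 'b::real_normed_vector \<Rightarrow> 'a)"
  by (rule lipschitz_onI) (auto simp: dist_fst_le)

lemma lipschitz_on_snd:
  "1-lipschitz_on A (snd :: 'a::real_normed_vector \<times> 'b::real_normed_vector \<Rightarrow> 'b)"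
  by (rule lipschitz_onI) (auto simp: dist_snd_le)

lemma lipschitz_on_abs: "1-lipschitz_on A (abs :: real \<Rightarrow> real)"
  by (rule lipschitz_onI) (auto simp: dist_real_def)

lemma lipschitz_on_Pair_left:
  "1-lipschitz_on A (Pair (x :: 'a::real_normed_vector) :: 'b::real_normed_vector \<Rightarrow> _)"
  by (rule lipschitz_onI) (auto simp: dist_Pair_Pair)

lemma identically_distributedD:
  assumes "identically_distributed E\<^sub>1 X\<^sub>1 E\<^sub>2 X\<^sub>2" "\<phi> \<in> C_bLip"
  shows "E\<^sub>1 (\<lambda>\<omega>. \<phi> (X\<^sub>1 \<omega>)) = E\<^sub>2 (\<lambda>\<omega>. \<phi> (X\<^sub>2 \<omega>))"
  using assms unfolding identically_distributed_def by blast

text \<open>Lets the truncation error tend to zero: in the applications \<open>C\<close> is a sum of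
  moments that does not depend on \<open>e\<close>.\<close>

lemma eq_if_dist_le_every_multiple:
  fixes a b C :: real
  assumes "\<And>e. e > 0 \<Longrightarrow> \<bar>a - b\<bar> \<le> e * C"
  shows "a = b"
proof (rule ccontr)
  assume "a \<noteq> b"
  \<comment> \<open>The denominator \<open>1 + \<bar>C\<bar>\<close> is positive and dominates
    \<open>C\<close> whatever its sign.\<close>
  define e where "e = \<bar>a - b\<bar> / (2 * (1 + \<bar>C\<bar>))"
  have pos: "\<bar>a - b\<bar> > 0" using \<open>a \<noteq> b\<close> by simp
  then have "e > 0" by (auto simp: e_def intro!: divide_pos_pos)
  then have "\<bar>a - b\<bar> \<le> e * C" by (rule assms)
  also have "\<dots> \<le> e * (1 + \<bar>C\<bar>)" using \<open>e > 0\<close> by (intro mult_left_mono) auto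
  also have "\<dots> = \<bar>a - b\<bar> / 2" by (simp add: e_def field_simps)
  finally show False using pos by simp
qed

lemma lipschitz_on_affine: "(0 + \<bar>c\<bar> * 1)-lipschitz_on A (\<lambda>y::real. x + c * y)"
  by (intro lipschitz_on_add lipschitz_on_cmult_real lipschitz_on_constant lipschitz_on_id)

lemma lipschitz_on_linear_pair:
  "(\<bar>p\<bar> * 1 + \<bar>q\<bar> * 1)-lipschitz_on A (\<lambda>z::real \<times> real. p * fst z + q * snd z)"
  by (intro lipschitz_on_add lipschitz_on_cmult_real lipschitz_on_fst lipschitz_on_snd)

section \<open>Semigroup law and shift operators\<close>

text \<open>Splitting \<open>s\<close> as \<open>r s / (1 + r) + s / (1 + r)\<close> turns validity for \<open>s \<le> r t\<close> into validity for
  \<open>s \<le> r (1 + r) t\<close>, so the admissible ratios \<open>s / t\<close> grow geometrically.\<close>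

lemma semigroup_law_extend:
  fixes Q :: "real \<Rightarrow> 'b \<Rightarrow> 'b"
  assumes D: "\<And>s x. x \<in> D \<Longrightarrow> Q s x \<in> D" and Q0: "\<And>x. Q 0 x = x" and r: "0 < r"
    and base: "\<And>s t x. 0 \<le> s \<Longrightarrow> 0 < t \<Longrightarrow> s \<le> r * t \<Longrightarrow> x \<in> D \<Longrightarrow> Q s (Q t x) = Q (s + t) x"
    and st: "0 \<le> s" "0 \<le> t" and x: "x \<in> D"
  shows "Q s (Q t x) = Q (s + t) x"
proof (cases "t = 0")
  case False
  with st have t: "t > 0" by simp
  have "Q s (Q t x) = Q (s + t) x" if "0 \<le> s" "0 < t" "s \<le> (r * (1 + r) ^ n) * t" "x \<in> D" for n s t x
    using that
  proof (induction n arbitrary: s t x)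
    case (Suc n)
    \<comment> \<open>\<open>q\<close> is the ratio granted by the induction hypothesis. The split
      \<open>s = a + b\<close> with \<open>a = q * b\<close> uses it to the full; as
      \<open>r \<le> q\<close>, the larger ratio \<open>q * (1 + r)\<close> is at most
      \<open>q * (1 + q)\<close>, which is what \<open>b \<le> q * t\<close> requires.\<close>
    define q where "q = r * (1 + r) ^ n"
    have "1 \<le> (1 + r) ^ n" using r by (intro one_le_power) simp
    then have q: "r \<le> q" using r by (simp add: q_def)
    then have q0: "0 < q" using r by simp
    define b where "b = s / (1 + q)"
    define a where a_eq: "a = q * b"
    have "(1 + q) * b = s" using q0 by (simp add: b_def)
    then have ab: "a + b = s" by (simp add: a_eq algebra_simps)
    have ab0: "0 \<le> a" "0 \<le> b" using Suc.prems q0 by (simp_all add: a_eq b_def)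
    have "s \<le> (q * (1 + r)) * t" using Suc.prems(3) by (simp add: q_def mult_ac)
    also have "\<dots> \<le> (q * (1 + q)) * t"
      using q q0 Suc.prems(2) by (intro mult_right_mono mult_left_mono) auto
    finally have bt: "b \<le> q * t" using q0 by (simp add: b_def pos_divide_le_eq mult_ac)
    have "Q s (Q t x) = Q a (Q b (Q t x))"
    \<comment> \<open>The induction hypothesis demands a positive inner time; if
      \<open>b = 0\<close>, then \<open>a\<close> and \<open>s\<close> vanish as well.\<close>
    proof (cases "b = 0")
      case True
      then show ?thesis using ab a_eq by (simp add: Q0)
    next
      case False
      then show ?thesis
        using Suc.IH[of a b "Q t x"] ab ab0 a_eq D Suc.prems by (simp add: q_def)
    qed
    also have "Q b (Q t x) = Q (b + t) x"
      using Suc.IH[of b t x] ab0 bt Suc.prems by (simp add: q_def)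
    also have "Q a (Q (b + t) x) = Q (a + (b + t)) x"
    proof (rule Suc.IH)
      show "a \<le> (r * (1 + r) ^ n) * (b + t)"
        using a_eq q0 Suc.prems(2) by (simp add: distrib_left flip: q_def)
    qed (use ab0 Suc.prems in auto)
    finally show ?case using ab by (simp add: add.assoc[symmetric])
  qed (simp add: base)
  \<comment> \<open>Since \<open>1 + r > 1\<close>, the admissible ratios are unbounded and
    eventually exceed \<open>s / t\<close>.\<close>
  moreover obtain n where "s / (r * t) < (1 + r) ^ n"
    using real_arch_pow[of "1 + r" "s / (r * t)"] r by auto
  then have "s \<le> (r * (1 + r) ^ n) * t"
    using r t by (simp add: pos_divide_less_eq mult_ac)
  ultimately show ?thesis using st t x by blast
qed (simp add: Q0)

text \<open>The sublinear counterpart of convolving a test function with the law of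
  \<open>a * X\<close>.\<close>

definition shift_expectation ::
  "(('w \<Rightarrow> real) \<Rightarrow> real) \<Rightarrow> ('w \<Rightarrow> real) \<Rightarrow> real \<Rightarrow> (real \<Rightarrow> real) \<Rightarrow> real \<Rightarrow> real" where
  "shift_expectation E X a \<phi> x = E (\<lambda>\<omega>. \<phi> (x + a * X \<omega>))"

section \<open>Calculus of sublinear expectations\<close>

context sublinear_expectation_space
begin

text \<open>Monotonicity and subadditivity replace linearity in all later error estimates.\<close>

lemma E_close:
  assumes "X \<in> H" "Y \<in> H" "D \<in> H" "\<And>\<omega>. \<bar>X \<omega> - Y \<omega>\<bar> \<le> D \<omega>"
  shows "\<bar>E X - E Y\<bar> \<le> E D"
proof -
  have "E X \<le> E (\<lambda>\<omega>. Y \<omega> + D \<omega>)"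
    using assms by (intro E_mono add_in_H) (auto simp: abs_le_iff algebra_simps)
  moreover have "E Y \<le> E (\<lambda>\<omega>. X \<omega> + D \<omega>)"
    using assms by (intro E_mono add_in_H) (auto simp: abs_le_iff algebra_simps)
  ultimately show ?thesis
    using E_subadd[of Y D] E_subadd[of X D] assms by linarith
qed

lemma uminus_in_H: "X \<in> H \<Longrightarrow> (\<lambda>\<omega>. - X \<omega>) \<in> H"
  using scale_in_H[of X "-1"] by simp

text \<open>Subadditivity gives one inequality directly; applied to \<open>- X\<close> and
  \<open>X + Y\<close> it gives the other.\<close>

lemma E_add_no_uncertainty:
  assumes "X \<in> H" "Y \<in> H" "E X = m" "E (\<lambda>\<omega>. - X \<omega>) = - m"
  shows "E (\<lambda>\<omega>. X \<omega> + Y \<omega>) = m + E Y"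
proof (rule antisym)
  show "E (\<lambda>\<omega>. X \<omega> + Y \<omega>) \<le> m + E Y" using E_subadd assms by auto
  have "E (\<lambda>\<omega>. - X \<omega> + (X \<omega> + Y \<omega>)) \<le> - m + E (\<lambda>\<omega>. X \<omega> + Y \<omega>)"
    using assms E_subadd uminus_in_H add_in_H by metis
  then show "m + E Y \<le> E (\<lambda>\<omega>. X \<omega> + Y \<omega>)" by simp
qed

lemma E_add_const: "X \<in> H \<Longrightarrow> E (\<lambda>\<omega>. c + X \<omega>) = c + E X"
  by (rule E_add_no_uncertainty) (auto simp: const_in_H E_const)

lemma E_scale_no_mean:
  assumes "X \<in> H" "E X = 0" "E (\<lambda>\<omega>. - X \<omega>) = 0"
  shows "E (\<lambda>\<omega>. c * X \<omega>) = 0"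
proof (cases "c \<ge> 0")
  case True
  then show ?thesis using E_pos_homogeneous assms by simp
next
  case False
  then show ?thesis using E_pos_homogeneous[OF uminus_in_H, of X "-c"] assms by simp
qed

end

section \<open>Extending distributional identities to unbounded functions\<close>

context sublinear_expectation_space_with_test_functions
begin

lemma mult_in_H:
  assumes "X \<in> H" "Y \<in> H"
  shows "(\<lambda>\<omega>. X \<omega> * Y \<omega>) \<in> H"
proof -
  \<comment> \<open>Polarization expresses the product through squares.\<close>
  have "(\<lambda>\<omega>. (1/2) * ((X \<omega> + Y \<omega>)\<^sup>2 + (-1) * ((X \<omega>)\<^sup>2 + (Y \<omega>)\<^sup>2))) \<in> H"
    using assms by (intro scale_in_H add_in_H square_in_H)
  then show ?thesis by (simp add: power2_eq_square algebra_simps)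
qed

lemma power_in_H: "X \<in> H \<Longrightarrow> (\<lambda>\<omega>. X \<omega> ^ n) \<in> H"
  by (induction n) (auto intro: const_in_H mult_in_H)

lemmas H_intros = const_in_H add_in_H scale_in_H abs_in_H uminus_in_H mult_in_H power_in_H

text \<open>Truncation costs \<open>e\<close> times second and fourth moments, which are finite
  because \<open>H\<close> is closed under powers. The product form covers \<open>x\<close>,
  \<open>- x\<close>, \<open>\<bar>x\<bar>\<close> and the square at once.\<close>

lemma identically_distributed_lipschitz_product:
  assumes H: "X \<in> H" "Y \<in> H" "(\<lambda>\<omega>. h (X \<omega>)) \<in> H" "(\<lambda>\<omega>. h (Y \<omega>)) \<in> H"
    and id: "identically_distributed E X E Y"
    and h: "\<And>x. h x = u x * v x" "L-lipschitz_on UNIV u" "M-lipschitz_on UNIV v"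
  shows "E (\<lambda>\<omega>. h (X \<omega>)) = E (\<lambda>\<omega>. h (Y \<omega>))"
proof (rule eq_if_dist_le_every_multiple)
  let ?w = "\<lambda>X \<omega>. (X \<omega>)\<^sup>2 + (X \<omega>)^4"
  fix e :: real assume e: "e > 0"
  then obtain \<phi> where \<phi>: "\<phi> \<in> C_bLip" "\<And>x. \<bar>h x - \<phi> x\<bar> \<le> e * (x\<^sup>2 + x^4)"
    using lipschitz_product_truncation[OF h(2,3) e] by (auto simp: h(1))
  have "\<bar>E (\<lambda>\<omega>. h (Z \<omega>)) - E (\<lambda>\<omega>. \<phi> (Z \<omega>))\<bar> \<le> e * E (?w Z)"
    if "Z \<in> H" "(\<lambda>\<omega>. h (Z \<omega>)) \<in> H" for Z
  proof -
    have "\<bar>E (\<lambda>\<omega>. h (Z \<omega>)) - E (\<lambda>\<omega>. \<phi> (Z \<omega>))\<bar> \<le> E (\<lambda>\<omega>. e * ?w Z \<omega>)"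
      by (rule E_close[OF that(2) test_in_H[OF that(1) \<phi>(1)] _ \<phi>(2)]) (intro H_intros that(1))
    also have "\<dots> = e * E (?w Z)"
      using that e by (intro E_pos_homogeneous add_in_H power_in_H) simp_all
    finally show ?thesis .
  qed
  note this[OF H(1,3)] this[OF H(2,4)]
  moreover have "E (\<lambda>\<omega>. \<phi> (X \<omega>)) = E (\<lambda>\<omega>. \<phi> (Y \<omega>))"
    by (rule identically_distributedD[OF id \<phi>(1)])
  ultimately have "\<bar>E (\<lambda>\<omega>. h (X \<omega>)) - E (\<lambda>\<omega>. h (Y \<omega>))\<bar> \<le> e * E (?w X) + e * E (?w Y)"
    by linarith
  then show "\<bar>E (\<lambda>\<omega>. h (X \<omega>)) - E (\<lambda>\<omega>. h (Y \<omega>))\<bar> \<le> e * (E (?w X) + E (?w Y))"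
    by (simp add: algebra_simps)
qed

text \<open>The Lipschitz estimate in \<open>x\<close> is uniform in the sample point, so it
  survives the expectation. Hence the inner expectation in the definition of independence is again a
  test function.\<close>

lemma C_bLip_expectation:
  assumes Z: "\<And>x. (\<lambda>\<omega>. \<phi> (x, Y \<omega>)) \<in> H" and \<phi>: "\<phi> \<in> C_bLip"
  shows "(\<lambda>x. E (\<lambda>\<omega>. \<phi> (x, Y \<omega>))) \<in> (C_bLip :: ('b::euclidean_space \<Rightarrow> real) set)"
proof -
  obtain L B where L: "L-lipschitz_on UNIV \<phi>" and B: "\<And>z. \<bar>\<phi> z\<bar> \<le> B"
    using \<phi> by (rule C_bLipE) blast
  show ?thesis
  proof (rule C_bLipI)
    show "L-lipschitz_on UNIV (\<lambda>x. E (\<lambda>\<omega>. \<phi> (x, Y \<omega>)))"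
    proof (rule lipschitz_onI)
      fix x y :: 'b
      have "\<bar>E (\<lambda>\<omega>. \<phi> (x, Y \<omega>)) - E (\<lambda>\<omega>. \<phi> (y, Y \<omega>))\<bar> \<le> E (\<lambda>_. L * dist x y)"
      proof (intro E_close Z const_in_H)
        show "\<bar>\<phi> (x, Y \<omega>) - \<phi> (y, Y \<omega>)\<bar> \<le> L * dist x y" for \<omega>
          using lipschitz_onD[OF L, of "(x, Y \<omega>)" "(y, Y \<omega>)"]
          by (simp add: dist_real_def dist_Pair_Pair)
      qed
      then show "dist (E (\<lambda>\<omega>. \<phi> (x, Y \<omega>))) (E (\<lambda>\<omega>. \<phi> (y, Y \<omega>))) \<le> L * dist x y"
        by (simp add: dist_real_def E_const)
    qed (use L lipschitz_on_nonneg in blast)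
    show "\<bar>E (\<lambda>\<omega>. \<phi> (x, Y \<omega>))\<bar> \<le> B" for x
      using E_close[OF Z[of x] const_in_H[of 0] const_in_H[of B]] B by (simp add: E_const)
  qed
qed

lemma section_in_H:
  fixes \<phi> :: "real \<times> real \<Rightarrow> real"
  assumes "Y \<in> H" "\<phi> \<in> C_bLip"
  shows "(\<lambda>\<omega>. \<phi> (x, Y \<omega>)) \<in> H"
  by (rule test_in_H[OF assms(1) C_bLip_compose[OF assms(2) lipschitz_on_Pair_left]])

text \<open>Independence for functions of quadratic growth. Both the joint function and its
  conditional expectation \<open>g\<close> are compared with those of one truncation
  \<open>\<phi>\<close>.\<close>

lemma independent_lipschitz_product:
  fixes u v :: "real \<times> real \<Rightarrow> real"
  assumes H: "X \<in> H" "Y \<in> H" "(\<lambda>\<omega>. h (X \<omega>) (Y \<omega>)) \<in> H" "\<And>x. (\<lambda>\<omega>. h x (Y \<omega>)) \<in> H"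
      "(\<lambda>\<omega>. g (X \<omega>)) \<in> H"
    and ind: "independent_of E Y X"
    and h: "\<And>x y. h x y = u (x, y) * v (x, y)" "L-lipschitz_on UNIV u" "M-lipschitz_on UNIV v"
    and g: "\<And>x. E (\<lambda>\<omega>. h x (Y \<omega>)) = g x"
  shows "E (\<lambda>\<omega>. h (X \<omega>) (Y \<omega>)) = E (\<lambda>\<omega>. g (X \<omega>))"
proof (rule eq_if_dist_le_every_multiple)
  \<comment> \<open>The factor 2 comes from
    \<open>(x\<^sup>2 + y\<^sup>2)\<^sup>2 \<le> 2 * x^4 + 2 * y^4\<close>; it splits the error
    weight of the pair into a function of \<open>x\<close> plus a function of
    \<open>y\<close>.\<close>
  define w :: "real \<Rightarrow> real" where "w x = x\<^sup>2 + 2 * x^4" for x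
  have w_in_H: "(\<lambda>\<omega>. w (Z \<omega>)) \<in> H" if "Z \<in> H" for Z
    unfolding w_def using that by (intro H_intros)
  have norm_w: "(norm (x, y))\<^sup>2 + (norm (x, y))^4 \<le> w x + w y" for x y :: real
  proof -
    have "0 \<le> (x\<^sup>2 - y\<^sup>2)\<^sup>2" by simp
    moreover have "(norm (x, y))^4 = ((norm (x, y))\<^sup>2)\<^sup>2" by simp
    ultimately show ?thesis
      by (simp add: norm_Pair w_def power2_eq_square power4_eq_xxxx algebra_simps)
  qed
  fix e :: real assume e: "e > 0"
  then obtain \<phi> where \<phi>: "\<phi> \<in> C_bLip"
    and "\<And>z. \<bar>u z * v z - \<phi> z\<bar> \<le> e * ((norm z)\<^sup>2 + (norm z)^4)"
    using lipschitz_product_truncation[OF h(2,3) e] by auto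
  then have close: "\<bar>h x y - \<phi> (x, y)\<bar> \<le> e * (w x + w y)" for x y
    unfolding h(1) using e by (meson norm_w mult_left_mono order_trans less_imp_le)
  let ?g = "\<lambda>x. E (\<lambda>\<omega>. \<phi> (x, Y \<omega>))"
  have "\<bar>E (\<lambda>\<omega>. h (X \<omega>) (Y \<omega>)) - E (\<lambda>\<omega>. \<phi> (X \<omega>, Y \<omega>))\<bar> \<le> E (\<lambda>\<omega>. e * (w (X \<omega>) + w (Y \<omega>)))"
    using close by (intro E_close H(3) test2_in_H[OF H(1,2) \<phi>] H_intros w_in_H H)
  also have "\<dots> = e * E (\<lambda>\<omega>. w (X \<omega>) + w (Y \<omega>))"
    using e by (intro E_pos_homogeneous add_in_H w_in_H H) simp
  also have "\<dots> \<le> e * (E (\<lambda>\<omega>. w (X \<omega>)) + E (\<lambda>\<omega>. w (Y \<omega>)))"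
    using e by (intro mult_left_mono E_subadd w_in_H H) simp
  finally have 1: "\<bar>E (\<lambda>\<omega>. h (X \<omega>) (Y \<omega>)) - E (\<lambda>\<omega>. \<phi> (X \<omega>, Y \<omega>))\<bar>
    \<le> e * (E (\<lambda>\<omega>. w (X \<omega>)) + E (\<lambda>\<omega>. w (Y \<omega>)))" .
  have gclose: "\<bar>g x - ?g x\<bar> \<le> e * (E (\<lambda>\<omega>. w (Y \<omega>)) + w x)" for x
  proof -
    have "\<bar>g x - ?g x\<bar> \<le> E (\<lambda>\<omega>. e * (w x + w (Y \<omega>)))"
      unfolding g[symmetric]
      using close by (intro E_close H(4) section_in_H[OF H(2) \<phi>] H_intros w_in_H H(2))
    also have "\<dots> = e * (w x + E (\<lambda>\<omega>. w (Y \<omega>)))"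
      using e w_in_H[OF H(2)] by (simp add: E_pos_homogeneous E_add_const add_in_H const_in_H)
    finally show ?thesis by (simp add: algebra_simps)
  qed
  have g_in_C: "?g \<in> C_bLip"
    by (intro C_bLip_expectation section_in_H[OF H(2) \<phi>] \<phi>)
  have "\<bar>E (\<lambda>\<omega>. g (X \<omega>)) - E (\<lambda>\<omega>. ?g (X \<omega>))\<bar> \<le> E (\<lambda>\<omega>. e * (E (\<lambda>\<omega>. w (Y \<omega>)) + w (X \<omega>)))"
    using gclose by (intro E_close H(5) test_in_H[OF H(1) g_in_C] H_intros w_in_H H(1))
  also have "\<dots> = e * (E (\<lambda>\<omega>. w (Y \<omega>)) + E (\<lambda>\<omega>. w (X \<omega>)))"
    using e w_in_H[OF H(1)] by (simp add: E_pos_homogeneous E_add_const add_in_H const_in_H)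
  finally have 2: "\<bar>E (\<lambda>\<omega>. g (X \<omega>)) - E (\<lambda>\<omega>. ?g (X \<omega>))\<bar>
    \<le> e * (E (\<lambda>\<omega>. w (Y \<omega>)) + E (\<lambda>\<omega>. w (X \<omega>)))" .
  have "E (\<lambda>\<omega>. \<phi> (X \<omega>, Y \<omega>)) = E (\<lambda>\<omega>. ?g (X \<omega>))"
    using ind \<phi> unfolding independent_of_def by blast
  with 1 2 show "\<bar>E (\<lambda>\<omega>. h (X \<omega>) (Y \<omega>)) - E (\<lambda>\<omega>. g (X \<omega>))\<bar>
    \<le> e * (2 * (E (\<lambda>\<omega>. w (X \<omega>)) + E (\<lambda>\<omega>. w (Y \<omega>))))"
    by (simp add: algebra_simps)
qed

section \<open>Moments of stable combinations\<close>

lemma moments_eq_if_identically_distributed: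
  assumes "X \<in> H" "Y \<in> H" "identically_distributed E Y E X"
  shows "E Y = E X" "E (\<lambda>\<omega>. - Y \<omega>) = E (\<lambda>\<omega>. - X \<omega>)"
    "E (\<lambda>\<omega>. \<bar>Y \<omega>\<bar>) = E (\<lambda>\<omega>. \<bar>X \<omega>\<bar>)" "E (\<lambda>\<omega>. (Y \<omega>)\<^sup>2) = E (\<lambda>\<omega>. (X \<omega>)\<^sup>2)"
proof -
  note eqI = identically_distributed_lipschitz_product[OF assms(2,1) _ _ assms(3)]
  note lip = lipschitz_on_id lipschitz_on_constant[where c = "1::real"] lipschitz_on_abs
    lipschitz_on_constant[where c = "- 1 :: real"]
  show "E Y = E X"
    by (rule eqI[where h = "\<lambda>x. x" and u = "\<lambda>x. x" and v = "\<lambda>_. 1"])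
      (use assms in \<open>auto intro: lip\<close>)
  show "E (\<lambda>\<omega>. - Y \<omega>) = E (\<lambda>\<omega>. - X \<omega>)"
    by (rule eqI[where h = "\<lambda>x. - x" and u = "\<lambda>x. x" and v = "\<lambda>_. - 1"])
      (use assms in \<open>auto intro: lip uminus_in_H\<close>)
  show "E (\<lambda>\<omega>. \<bar>Y \<omega>\<bar>) = E (\<lambda>\<omega>. \<bar>X \<omega>\<bar>)"
    by (rule eqI[where h = abs and u = abs and v = "\<lambda>_. 1"])
      (use assms in \<open>auto intro: lip abs_in_H\<close>)
  show "E (\<lambda>\<omega>. (Y \<omega>)\<^sup>2) = E (\<lambda>\<omega>. (X \<omega>)\<^sup>2)"
    by (rule eqI[where h = "\<lambda>x. x\<^sup>2" and u = "\<lambda>x. x" and v = "\<lambda>x. x"])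
      (use assms in \<open>auto intro: lip mult_in_H simp: power2_eq_square\<close>)
qed

text \<open>The nonnegative \<open>l\<close> and \<open>k\<close> come out by positive homogeneity,
  while \<open>s\<close> stays inside and may be negative: \<open>s = 1\<close> concerns the upper
  mean, \<open>s = -1\<close> the negated lower mean.\<close>

lemma E_linear_combination_independent:
  assumes H: "X \<in> H" "Y \<in> H" and ind: "independent_of E Y X" and "l \<ge> 0" "k \<ge> 0"
  shows "E (\<lambda>\<omega>. s * (l * X \<omega> + k * Y \<omega>)) = l * E (\<lambda>\<omega>. s * X \<omega>) + k * E (\<lambda>\<omega>. s * Y \<omega>)"
proof -
  note HI = const_in_H add_in_H scale_in_H
  let ?m = "k * E (\<lambda>\<omega>. s * Y \<omega>)"
  have "E (\<lambda>\<omega>. s * (l * X \<omega> + k * Y \<omega>)) = E (\<lambda>\<omega>. ?m + l * (s * X \<omega>))"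
  proof (rule independent_lipschitz_product[where g = "\<lambda>x. ?m + l * (s * x)"
        and h = "\<lambda>x y. s * (l * x + k * y)" and u = "\<lambda>z. l * fst z + k * snd z"
        and v = "\<lambda>_. s"])
    show "E (\<lambda>\<omega>. s * (l * x + k * Y \<omega>)) = ?m + l * (s * x)" for x
    proof -
      have "E (\<lambda>\<omega>. s * (l * x + k * Y \<omega>)) = E (\<lambda>\<omega>. l * (s * x) + k * (s * Y \<omega>))"
        by (simp add: algebra_simps)
      also have "\<dots> = l * (s * x) + E (\<lambda>\<omega>. k * (s * Y \<omega>))"
        by (intro E_add_const HI H)
      also have "E (\<lambda>\<omega>. k * (s * Y \<omega>)) = ?m"
        using assms by (intro E_pos_homogeneous HI H)
      finally show ?thesis by simp
    qed
    show "s * (l * x + k * y) = (l * fst (x, y) + k * snd (x, y)) * s" for x y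
      by simp
  qed (rule HI H ind lipschitz_on_linear_pair lipschitz_on_constant)+
  also have "\<dots> = ?m + E (\<lambda>\<omega>. l * (s * X \<omega>))"
    by (intro E_add_const HI H)
  also have "E (\<lambda>\<omega>. l * (s * X \<omega>)) = l * E (\<lambda>\<omega>. s * X \<omega>)"
    using assms by (intro E_pos_homogeneous HI H)
  finally show ?thesis by simp
qed

text \<open>With \<open>x\<close> frozen, \<open>\<bar>x\<bar>\<close> is a nonnegative constant and
  leaves the inner expectation; the nonnegative \<open>?m\<close> then leaves the outer one.\<close>

lemma E_abs_product_independent:
  assumes H: "X \<in> H" "Y \<in> H" and ind: "independent_of E Y X"
  shows "E (\<lambda>\<omega>. \<bar>X \<omega>\<bar> * \<bar>Y \<omega>\<bar>) = E (\<lambda>\<omega>. \<bar>X \<omega>\<bar>) * E (\<lambda>\<omega>. \<bar>Y \<omega>\<bar>)"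
proof -
  note HI = scale_in_H abs_in_H
  let ?m = "E (\<lambda>\<omega>. \<bar>Y \<omega>\<bar>)"
  have "0 \<le> ?m"
    using E_mono[OF abs_in_H[OF H(2)] const_in_H[of 0]] by (simp add: E_const)
  have "E (\<lambda>\<omega>. \<bar>X \<omega>\<bar> * \<bar>Y \<omega>\<bar>) = E (\<lambda>\<omega>. ?m * \<bar>X \<omega>\<bar>)"
  proof (rule independent_lipschitz_product[where h = "\<lambda>x y. \<bar>x\<bar> * \<bar>y\<bar>" and g = "\<lambda>x. ?m * \<bar>x\<bar>"
        and u = "\<lambda>z. \<bar>fst z\<bar>" and v = "\<lambda>z. \<bar>snd z\<bar>"])
    show "E (\<lambda>\<omega>. \<bar>x\<bar> * \<bar>Y \<omega>\<bar>) = ?m * \<bar>x\<bar>" for x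
      using E_pos_homogeneous[of "\<lambda>\<omega>. \<bar>Y \<omega>\<bar>" "\<bar>x\<bar>"] abs_in_H[OF H(2)] by simp
    show "(1 * 1)-lipschitz_on UNIV (\<lambda>z::real \<times> real. \<bar>fst z\<bar>)"
      by (intro lipschitz_on_compose2[OF lipschitz_on_fst] lipschitz_on_abs)
    show "(1 * 1)-lipschitz_on UNIV (\<lambda>z::real \<times> real. \<bar>snd z\<bar>)"
      by (intro lipschitz_on_compose2[OF lipschitz_on_snd] lipschitz_on_abs)
  qed (simp_all add: H ind mult_in_H HI)
  also have "\<dots> = ?m * E (\<lambda>\<omega>. \<bar>X \<omega>\<bar>)"
    using \<open>0 \<le> ?m\<close> by (intro E_pos_homogeneous abs_in_H H)
  finally show ?thesis by simp
qed

text \<open>A nonzero upper or lower mean would force \<open>k = 1 - l\<close>, for which the cross term of the second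
  moment is too small as soon as \<open>X\<close> is non-degenerate.\<close>

lemma mean_zero_if_stable:
  assumes H: "X \<in> H" and nd: "non_degenerate E X" and copy: "independent_copy H E Y X"
    and l: "0 < l" "l < 1" and k: "0 \<le> k"
    and stable: "identically_distributed E (\<lambda>\<omega>. l * X \<omega> + k * Y \<omega>) E X"
  shows "E X = 0" "E (\<lambda>\<omega>. - X \<omega>) = 0"
proof -
  have Y: "Y \<in> H" and id: "identically_distributed E Y E X" and ind: "independent_of E Y X"
    using copy by (auto simp: independent_copy_def)
  let ?Z = "\<lambda>\<omega>. l * X \<omega> + k * Y \<omega>"
  let ?m = "E (\<lambda>\<omega>. (X \<omega>)\<^sup>2)" and ?a = "E (\<lambda>\<omega>. \<bar>X \<omega>\<bar>)"
  have Z: "?Z \<in> H" using H Y by (intro add_in_H scale_in_H)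
  note momY = moments_eq_if_identically_distributed[OF H Y id] and momZ = moments_eq_if_identically_distributed[OF H Z stable]
  have "l + k \<noteq> 1"
  proof
    assume "l + k = 1"
    then have k_def: "k = 1 - l" by simp
    have "0 < k" using k_def l by simp
    let ?D = "\<lambda>\<omega>. l\<^sup>2 * (X \<omega>)\<^sup>2 + (k\<^sup>2 * (Y \<omega>)\<^sup>2 + (2 * l * k) * (\<bar>X \<omega>\<bar> * \<bar>Y \<omega>\<bar>))"
    have in_H: "(\<lambda>\<omega>. l\<^sup>2 * (X \<omega>)\<^sup>2) \<in> H" "(\<lambda>\<omega>. k\<^sup>2 * (Y \<omega>)\<^sup>2) \<in> H"
      "(\<lambda>\<omega>. (2 * l * k) * (\<bar>X \<omega>\<bar> * \<bar>Y \<omega>\<bar>)) \<in> H"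
      by (intro scale_in_H mult_in_H abs_in_H square_in_H H Y)+
    have "?m = E (\<lambda>\<omega>. (?Z \<omega>)\<^sup>2)" by (simp only: momZ)
    also have "\<dots> \<le> E ?D"
    proof (intro E_mono square_in_H[OF Z] add_in_H in_H)
      fix \<omega>
      have "(l * k) * (X \<omega> * Y \<omega>) \<le> (l * k) * (\<bar>X \<omega>\<bar> * \<bar>Y \<omega>\<bar>)"
        using l k by (intro mult_left_mono) (auto simp flip: abs_mult)
      then show "(?Z \<omega>)\<^sup>2 \<le> ?D \<omega>"
        by (simp add: power2_eq_square algebra_simps)
    qed
    also have "\<dots> \<le> E (\<lambda>\<omega>. l\<^sup>2 * (X \<omega>)\<^sup>2)
        + (E (\<lambda>\<omega>. k\<^sup>2 * (Y \<omega>)\<^sup>2) + E (\<lambda>\<omega>. (2 * l * k) * (\<bar>X \<omega>\<bar> * \<bar>Y \<omega>\<bar>)))"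
      using E_subadd[OF in_H(1) add_in_H[OF in_H(2,3)]] E_subadd[OF in_H(2,3)] by linarith
    also have "\<dots> = l\<^sup>2 * ?m + (k\<^sup>2 * ?m + (2 * l * k) * (?a * ?a))"
      using l k H Y ind
      by (simp add: E_pos_homogeneous square_in_H mult_in_H abs_in_H E_abs_product_independent momY)
    \<comment> \<open>Non-degeneracy enters here; strictness needs \<open>l * k > 0\<close>.\<close>
    also have "\<dots> < l\<^sup>2 * ?m + (k\<^sup>2 * ?m + (2 * l * k) * ?m)"
      using nd l \<open>0 < k\<close> by (simp add: non_degenerate_def power2_eq_square)
    also have "\<dots> = (l + k)\<^sup>2 * ?m" by (simp add: power2_sum algebra_simps)
    also have "\<dots> = ?m" by (simp add: k_def)
    finally show False by simp
  qed
  \<comment> \<open>Stability makes both \<open>E X\<close> and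
    \<open>E (\<lambda>\<omega>. - X \<omega>)\<close> fixed under multiplication by
    \<open>l + k\<close>.\<close>
  then have x_eq_0: "x = 0" if "(l + k) * x = x" for x
    using that by simp
  show "E X = 0"
    using E_linear_combination_independent[OF H Y ind _ k, of l 1] l momY(1) momZ(1)
    by (intro x_eq_0) (simp add: algebra_simps)
  show "E (\<lambda>\<omega>. - X \<omega>) = 0"
    using E_linear_combination_independent[OF H Y ind _ k, of l "-1"] l momY(2) momZ(2)
    by (intro x_eq_0) (simp add: distrib_right)
qed

text \<open>With \<open>x\<close> frozen, the cross term is a multiple of \<open>Y\<close>, whose
  upper and lower means vanish, so it drops out for either sign of its coefficient.\<close>

lemma second_moment_independent_sum:
  assumes H: "X \<in> H" "Y \<in> H" and ind: "independent_of E Y X"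
    and mean: "E Y = 0" "E (\<lambda>\<omega>. - Y \<omega>) = 0"
  shows "E (\<lambda>\<omega>. (l * X \<omega> + k * Y \<omega>)\<^sup>2)
    = l\<^sup>2 * E (\<lambda>\<omega>. (X \<omega>)\<^sup>2) + k\<^sup>2 * E (\<lambda>\<omega>. (Y \<omega>)\<^sup>2)"
proof -
  note HI = const_in_H scale_in_H square_in_H add_in_H
  let ?m = "k\<^sup>2 * E (\<lambda>\<omega>. (Y \<omega>)\<^sup>2)"
  have "E (\<lambda>\<omega>. (l * X \<omega> + k * Y \<omega>)\<^sup>2) = E (\<lambda>\<omega>. ?m + l\<^sup>2 * (X \<omega>)\<^sup>2)"
  proof (rule independent_lipschitz_product[where h = "\<lambda>x y. (l * x + k * y)\<^sup>2"
        and g = "\<lambda>x. ?m + l\<^sup>2 * x\<^sup>2" and u = "\<lambda>z. l * fst z + k * snd z"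
        and v = "\<lambda>z. l * fst z + k * snd z"])
    show "E (\<lambda>\<omega>. (l * x + k * Y \<omega>)\<^sup>2) = ?m + l\<^sup>2 * x\<^sup>2" for x
    proof -
      have "E (\<lambda>\<omega>. (l * x + k * Y \<omega>)\<^sup>2)
          = E (\<lambda>\<omega>. (2 * l * x * k) * Y \<omega> + (l\<^sup>2 * x\<^sup>2 + k\<^sup>2 * (Y \<omega>)\<^sup>2))"
        by (simp add: power2_eq_square algebra_simps)
      also have "\<dots> = 0 + E (\<lambda>\<omega>. l\<^sup>2 * x\<^sup>2 + k\<^sup>2 * (Y \<omega>)\<^sup>2)"
        using E_scale_no_mean[OF H(2) mean, of "- (2 * l * x * k)"]
        by (intro E_add_no_uncertainty HI H) (simp_all add: E_scale_no_mean[OF H(2) mean])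
      also have "\<dots> = l\<^sup>2 * x\<^sup>2 + E (\<lambda>\<omega>. k\<^sup>2 * (Y \<omega>)\<^sup>2)"
        by (simp only: add_0 E_add_const[OF scale_in_H[OF square_in_H[OF H(2)]]])
      also have "E (\<lambda>\<omega>. k\<^sup>2 * (Y \<omega>)\<^sup>2) = ?m"
        by (intro E_pos_homogeneous HI H) simp
      finally show ?thesis by simp
    qed
    show "(l * x + k * y)\<^sup>2 = (l * fst (x, y) + k * snd (x, y)) * (l * fst (x, y) + k * snd (x, y))"
      for x y by (simp add: power2_eq_square)
  qed (rule HI H ind lipschitz_on_linear_pair)+
  also have "\<dots> = ?m + E (\<lambda>\<omega>. l\<^sup>2 * (X \<omega>)\<^sup>2)"
    by (intro E_add_const HI H)
  also have "E (\<lambda>\<omega>. l\<^sup>2 * (X \<omega>)\<^sup>2) = l\<^sup>2 * E (\<lambda>\<omega>. (X \<omega>)\<^sup>2)"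
    by (intro E_pos_homogeneous HI H) simp
  finally show ?thesis by simp
qed

lemma stable_coefficients:
  assumes H: "X \<in> H" and nd: "non_degenerate E X" and copy: "independent_copy H E Y X"
    and mean: "E X = 0" "E (\<lambda>\<omega>. - X \<omega>) = 0"
    and stable: "identically_distributed E (\<lambda>\<omega>. l * X \<omega> + k * Y \<omega>) E X"
  shows "l\<^sup>2 + k\<^sup>2 = 1"
proof -
  have Y: "Y \<in> H" and id: "identically_distributed E Y E X" and ind: "independent_of E Y X"
    using copy by (auto simp: independent_copy_def)
  let ?m = "E (\<lambda>\<omega>. (X \<omega>)\<^sup>2)"
  have Z: "(\<lambda>\<omega>. l * X \<omega> + k * Y \<omega>) \<in> H" using H Y by (intro add_in_H scale_in_H)
  note momY = moments_eq_if_identically_distributed[OF H Y id] and momZ = moments_eq_if_identically_distributed[OF H Z stable]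
  have "?m = l\<^sup>2 * ?m + k\<^sup>2 * ?m"
    using second_moment_independent_sum[OF H Y ind, of l k] momY momZ(4) mean by simp
  then have "(l\<^sup>2 + k\<^sup>2) * ?m = 1 * ?m" by (simp add: distrib_right)
  moreover have "?m > 0"
    using nd unfolding non_degenerate_def by (rule le_less_trans[OF zero_le_power2])
  ultimately show ?thesis by simp
qed

section \<open>From stability to normality\<close>

lemma shift_expectation_C_bLip:
  assumes "X \<in> H" "\<phi> \<in> C_bLip"
  shows "shift_expectation E X a \<phi> \<in> C_bLip"
proof -
  have "(\<lambda>z. \<phi> (1 * fst z + a * snd z)) \<in> C_bLip"
    by (rule C_bLip_compose[OF assms(2) lipschitz_on_linear_pair])
  from C_bLip_expectation[OF section_in_H[OF assms(1) this] this]
  show ?thesis by (simp add: shift_expectation_def[abs_def])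
qed

text \<open>Independence freezes \<open>X\<close>, and the inner expectation sees only the law of
  \<open>Y\<close>, which is that of \<open>X\<close>. The right side therefore does not depend on
  the chosen copy.\<close>

lemma E_independent_copy_combination:
  assumes "X \<in> H" "independent_copy H E Y X" "\<phi> \<in> C_bLip"
  shows "E (\<lambda>\<omega>. \<phi> (a * X \<omega> + b * Y \<omega>))
    = shift_expectation E X a (shift_expectation E X b \<phi>) 0"
proof -
  have id: "identically_distributed E Y E X" and ind: "independent_of E Y X"
    using assms(2) by (auto simp: independent_copy_def)
  have copy_eq: "E (\<lambda>\<omega>. \<phi> (x + b * Y \<omega>)) = E (\<lambda>\<omega>. \<phi> (x + b * X \<omega>))" for x
  proof -
    have "(\<lambda>y. \<phi> (x + b * y)) \<in> C_bLip"
      by (rule C_bLip_compose[OF assms(3) lipschitz_on_affine])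
    from identically_distributedD[OF id this] show ?thesis .
  qed
  have "(\<lambda>z. \<phi> (a * fst z + b * snd z)) \<in> C_bLip"
    by (rule C_bLip_compose[OF assms(3) lipschitz_on_linear_pair])
  with ind have "E (\<lambda>\<omega>. \<phi> (a * X \<omega> + b * Y \<omega>)) = E (\<lambda>\<omega>. E (\<lambda>\<omega>'. \<phi> (a * X \<omega> + b * Y \<omega>')))"
    unfolding independent_of_def by fastforce
  also have "\<dots> = E (\<lambda>\<omega>. E (\<lambda>\<omega>'. \<phi> (a * X \<omega> + b * X \<omega>')))"
    by (simp only: copy_eq)
  finally show ?thesis by (simp add: shift_expectation_def)
qed

lemma shift_expectation_0: "shift_expectation E X 0 \<phi> = \<phi>"
  by (simp add: shift_expectation_def E_const fun_eq_iff)

text \<open>The semigroup \<open>s \<mapsto> shift_expectation E X (sqrt s)\<close> stands in for a sequence of further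
  independent copies, which need not exist on the given space.\<close>

lemma G_normalI:
  assumes H: "X \<in> H" and copy: "independent_copy H E Y X" and d: "d > 0"
    and stable: "\<And>l. 0 \<le> l \<Longrightarrow> l < d \<Longrightarrow> l \<le> 1 \<Longrightarrow>
      identically_distributed E (\<lambda>\<omega>. l * X \<omega> + sqrt (1 - l\<^sup>2) * Y \<omega>) E X"
  shows "G_normal H E X"
proof -
  let ?S = "shift_expectation E X"
  define Q where "Q s = ?S (sqrt s)" for s
  \<comment> \<open>The bound on \<open>s\<close> makes \<open>l\<^sup>2 = s / (s + t)\<close>
    smaller than \<open>d\<^sup>2\<close>, so that stability applies; the factor one half makes the
    inequality strict.\<close>
  have base: "Q s (Q t \<phi>) = Q (s + t) \<phi>"
    if st: "0 \<le> s" "0 < t" "s \<le> (d\<^sup>2 / 2) * t" and \<phi>: "\<phi> \<in> C_bLip" for s t \<phi>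
  proof
    fix x
    \<comment> \<open>Polar coordinates: \<open>sqrt s\<close> and \<open>sqrt t\<close> are
      \<open>c\<close> times the stable coefficients \<open>l\<close> and
      \<open>sqrt (1 - l\<^sup>2)\<close>.\<close>
    define c where "c = sqrt (s + t)"
    define l where "l = sqrt s / c"
    have c: "c > 0" "c\<^sup>2 = s + t" using st by (auto simp: c_def)
    have l2: "l\<^sup>2 = s / (s + t)" using st c by (simp add: l_def power_divide)
    have cl: "c * l = sqrt s" using c by (simp add: l_def)
    have "1 - l\<^sup>2 = t / (s + t)" using st by (simp add: l2 field_simps)
    then have ck: "c * sqrt (1 - l\<^sup>2) = sqrt t"
      using st by (simp add: c_def real_sqrt_divide)
    have "s < d\<^sup>2 * t"
      using st d by (smt (verit) field_sum_of_halves mult_pos_pos zero_less_power distrib_right)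
    also have "\<dots> \<le> d\<^sup>2 * (s + t)" using st by (intro mult_left_mono) auto
    finally have "l\<^sup>2 < d\<^sup>2" using st by (simp add: l2 pos_divide_less_eq)
    then have "l < d" using d by (simp add: power_less_imp_less_base)
    moreover have "0 \<le> l" using st c by (simp add: l_def)
    moreover have "l \<le> 1"
      using st c by (simp add: l_def c_def)
    ultimately have id: "identically_distributed E (\<lambda>\<omega>. l * X \<omega> + sqrt (1 - l\<^sup>2) * Y \<omega>) E X"
      by (intro stable)
    \<comment> \<open>Translating and rescaling the test function carries stability at the point 0
      and scale 1 to the point \<open>x\<close> and scale \<open>c\<close>.\<close>
    have \<psi>: "(\<lambda>y. \<phi> (x + c * y)) \<in> C_bLip"
      by (rule C_bLip_compose[OF \<phi> lipschitz_on_affine])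
    have "?S l (?S (sqrt (1 - l\<^sup>2)) (\<lambda>y. \<phi> (x + c * y))) 0 = E (\<lambda>\<omega>. \<phi> (x + c * X \<omega>))"
      unfolding E_independent_copy_combination[OF H copy \<psi>, symmetric]
      by (rule identically_distributedD[OF id \<psi>])
    moreover have "?S l (?S (sqrt (1 - l\<^sup>2)) (\<lambda>y. \<phi> (x + c * y))) 0
        = ?S (c * l) (?S (c * sqrt (1 - l\<^sup>2)) \<phi>) x"
      by (simp add: shift_expectation_def distrib_left add.assoc mult.assoc)
    ultimately show "Q s (Q t \<phi>) x = Q (s + t) \<phi> x"
      unfolding cl ck by (simp add: Q_def c_def shift_expectation_def)
  qed
  have Q_add: "Q s (Q t \<phi>) = Q (s + t) \<phi>" if "0 \<le> s" "0 \<le> t" "\<phi> \<in> C_bLip" for s t \<phi>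
  proof (rule semigroup_law_extend[where Q = Q and D = C_bLip])
    show "Q s \<psi> \<in> C_bLip" if "\<psi> \<in> C_bLip" for s \<psi>
      unfolding Q_def using that by (rule shift_expectation_C_bLip[OF H])
    show "Q 0 \<psi> = \<psi>" for \<psi> by (simp add: Q_def shift_expectation_0)
    show "0 < d\<^sup>2 / 2" using d by simp
  qed (use that base in auto)
  have "identically_distributed E (\<lambda>\<omega>. a * X \<omega> + b * X' \<omega>) E (\<lambda>\<omega>. sqrt (a\<^sup>2 + b\<^sup>2) * X \<omega>)"
    if X': "independent_copy H E X' X" and ab: "0 \<le> a" "0 \<le> b" for X' a b
    unfolding identically_distributed_def
  proof
    fix \<phi> :: "real \<Rightarrow> real" assume \<phi>: "\<phi> \<in> C_bLip"
    have "E (\<lambda>\<omega>. \<phi> (a * X \<omega> + b * X' \<omega>)) = Q (a\<^sup>2) (Q (b\<^sup>2) \<phi>) 0"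
      using ab by (simp add: Q_def E_independent_copy_combination[OF H X' \<phi>])
    also have "\<dots> = Q (a\<^sup>2 + b\<^sup>2) \<phi> 0" using \<phi> by (simp add: Q_add)
    finally show "E (\<lambda>\<omega>. \<phi> (a * X \<omega> + b * X' \<omega>)) = E (\<lambda>\<omega>. \<phi> (sqrt (a\<^sup>2 + b\<^sup>2) * X \<omega>))"
      by (simp add: Q_def shift_expectation_def)
  qed
  then show ?thesis using H copy unfolding G_normal_def by blast
qed

end

theorem theorem3p1:
  fixes H :: "('w \<Rightarrow> real) set"
    and E :: "('w \<Rightarrow> real) \<Rightarrow> real"
    and X Y :: "'w \<Rightarrow> real"
    and I :: "real set"
    and f :: "real \<Rightarrow> real"
  assumes "sublinear_expectation_space_with_test_functions H E"
    and "is_interval I" and "0 \<in> interior I"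
    and "\<forall>l\<in>I. f l \<ge> 0"
    and "X \<in> H" and "non_degenerate E X"
    and "independent_copy H E Y X"
    and "\<forall>l\<in>I. f l \<ge> 0 \<longrightarrow> identically_distributed E (\<lambda>\<omega>. l * X \<omega> + f l * Y \<omega>) E X"
  shows "G_normal H E X \<and> (\<forall>l\<in>I. f l = sqrt (1 - l\<^sup>2))"
proof -
  interpret sublinear_expectation_space_with_test_functions H E by (fact assms(1))
  obtain d where d: "d > 0" "ball 0 d \<subseteq> I"
    using assms(3) by (auto simp: mem_interior)
  have stable: "identically_distributed E (\<lambda>\<omega>. l * X \<omega> + f l * Y \<omega>) E X" if "l \<in> I" for l
    using assms(4,8) that by blast
  \<comment> \<open>A coefficient strictly between 0 and 1 inside the ball, as the mean-zero
    argument demands.\<close>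
  define l0 where "l0 = min d 1 / 2"
  have l0: "0 < l0" "l0 < 1" "l0 \<in> I"
    using d by (auto simp: l0_def subset_iff dist_real_def)
  \<comment> \<open>The means do not involve \<open>l\<close>, so one coefficient makes them vanish;
    the second moment identity then holds for every \<open>l\<close> in \<open>I\<close>, of either
    sign.\<close>
  note mean = mean_zero_if_stable[OF assms(5,6,7) l0(1,2) _ stable[OF l0(3)]]
  have f: "f l = sqrt (1 - l\<^sup>2)" if "l \<in> I" for l
  proof -
    have "l\<^sup>2 + (f l)\<^sup>2 = 1"
      using assms(4) l0(3) by (intro stable_coefficients[OF assms(5,6,7) mean stable[OF that]]) auto
    then have "(f l)\<^sup>2 = 1 - l\<^sup>2" by simp
    moreover have "f l \<ge> 0" using assms(4) that by blast
    ultimately show ?thesis by (simp add: real_sqrt_unique)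
  qed
  have "G_normal H E X"
  proof (rule G_normalI[OF assms(5,7) d(1)])
    fix l :: real assume "0 \<le> l" "l < d"
    then have "l \<in> I" using d by (auto simp: subset_iff dist_real_def)
    from stable[OF this] f[OF this]
    show "identically_distributed E (\<lambda>\<omega>. l * X \<omega> + sqrt (1 - l\<^sup>2) * Y \<omega>) E X" by simp
  qed
  with f show ?thesis by blast
qed

end
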